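(* Let $s\ge 2$ and let $\mathcal P\in\mathbb Z[x_1,\ldots,x_s]$. For $\mathbf P=(P_1,\ldots,P_s)$ with $P_j\ge 1$ define \[ N_{\mathcal P}(\mathbf P)=\sum_{\substack{\mathbf x\in\mathbb Z^s\\ |x_j|\le P_j\ (1\le j\le s)}}\mu\big(|\mathcal P(\mathbf x)|\big)^2, \] and define \[ \mathfrak S_{\mathcal P}=\prod_p\left(1-\frac{\rho_{\mathcal P}(p^2)}{p^{2s}}\right),\qquad \rho_{\mathcal P}(d)=\#\{\mathbf x\in(\mathbb Z/d\mathbb Z)^s:\ \mathcal P(\mathbf x)\equiv 0 \pmod d\}. \] If $\mathfrak S_{\mathcal P}=0$, then \[ N_{\mathcal P}(\mathbf P)=o(P_1\cdots P_s)\quad\text{as }\min_jP_j\to\infty. \]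
   Context: $\mu$ is the Möbius function, extended by $\mu(0)=0$ (so $\mu(|n|)^2=1$ exactly when $n\neq 0$ is squarefree). The product over primes $p$ is defined as the limit of the partial products $\prod_{p\le n}(1-\rho_{\mathcal P}(p^2)/p^{2s})$, which form a non-negative non-increasing sequence and so converge to a non-negative limit. *)

theory Defs
  imports
    "HOL-Analysis.Analysis"
    "HOL-Library.Poly_Mapping"
    "HOL-Library.Landau_Symbols"
    "HOL-Number_Theory.Cong"
    "HOL-Computational_Algebra.Squarefree"
begin

text \<open>
  A polynomial over \<open>\<int>\<close> whose indeterminates are indexed by \<open>'s\<close> is a finitely supported
  map from monomials (exponent vectors) to coefficients; with \<open>'s\<close> finite this is
  \<open>\<int>[x\<^sub>1, \<dots>, x\<^sub>s]\<close> for \<open>s = CARD('s)\<close>.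
\<close>

type_synonym 's int_mpoly = "('s \<Rightarrow>\<^sub>0 nat) \<Rightarrow>\<^sub>0 int"

definition mpoly_eval :: "'s::finite int_mpoly \<Rightarrow> ('s \<Rightarrow> int) \<Rightarrow> int" where
  "mpoly_eval F x = (\<Sum>m\<in>Poly_Mapping.keys F.
     Poly_Mapping.lookup F m * (\<Prod>j\<in>UNIV. x j ^ Poly_Mapping.lookup m j))"

definition moebius :: "nat \<Rightarrow> int" where
  "moebius n = (if n \<noteq> 0 \<and> squarefree n then (- 1) ^ card (prime_factors n) else 0)"

definition squarefree_count :: "'s::finite int_mpoly \<Rightarrow> ('s \<Rightarrow> real) \<Rightarrow> int" where
  "squarefree_count F P =
     (\<Sum>x | \<forall>j. \<bar>real_of_int (x j)\<bar> \<le> P j. (moebius (nat \<bar>mpoly_eval F x\<bar>))\<^sup>2)"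

text \<open>Points of \<open>(\<int>/d\<int>)\<^sup>s\<close> are given by their representatives with coordinates in
  \<open>{0..<d}\<close>.\<close>

definition rho :: "'s::finite int_mpoly \<Rightarrow> nat \<Rightarrow> nat" where
  "rho F d = card {x :: 's \<Rightarrow> int. (\<forall>j. x j \<in> {0..<int d}) \<and> [mpoly_eval F x = 0] (mod int d)}"

definition singular_partial :: "'s::finite int_mpoly \<Rightarrow> nat \<Rightarrow> real" where
  "singular_partial F n =
     (\<Prod>p | prime p \<and> p \<le> n. 1 - real (rho F (p\<^sup>2)) / real p ^ (2 * CARD('s)))"

definition singular_series :: "'s::finite int_mpoly \<Rightarrow> real" where
  "singular_series F = lim (singular_partial F)"

text \<open>\<^const>\<open>lim\<close> is only meaningful for convergent sequences, and \<^const>\<open>sum\<close>,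
  \<^const>\<open>card\<close> only for finite sets; the following lemmas show that this is the case here.\<close>

lemma finite_box: "finite {x :: 's::finite \<Rightarrow> int. \<forall>j. \<bar>real_of_int (x j)\<bar> \<le> P j}"
proof (rule finite_subset)
  show "{x :: 's \<Rightarrow> int. \<forall>j. \<bar>real_of_int (x j)\<bar> \<le> P j} \<subseteq> (\<Pi>\<^sub>E j\<in>UNIV. {\<lceil>- P j\<rceil>..\<lfloor>P j\<rfloor>})"
    by (auto simp: PiE_def Pi_def ceiling_le_iff le_floor_iff abs_le_iff minus_le_iff)
qed (auto intro: finite_PiE)

lemma residue_box: "{x :: 's::finite \<Rightarrow> int. \<forall>j. x j \<in> {0..<int d}} = (\<Pi>\<^sub>E j\<in>UNIV. {0..<int d})"
  by (auto simp: PiE_def Pi_def)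

lemma finite_residue_box: "finite {x :: 's::finite \<Rightarrow> int. \<forall>j. x j \<in> {0..<int d}}"
  unfolding residue_box by (intro finite_PiE) auto

lemma rho_le: "rho (F :: 's::finite int_mpoly) d \<le> d ^ CARD('s)"
proof -
  have "rho F d \<le> card {x :: 's \<Rightarrow> int. \<forall>j. x j \<in> {0..<int d}}"
    unfolding rho_def by (intro card_mono finite_residue_box) auto
  also have "\<dots> = d ^ CARD('s)"
    unfolding residue_box by (simp add: card_PiE)
  finally show ?thesis .
qed

lemma singular_factor:
  fixes F :: "'s::finite int_mpoly"
  assumes "prime p"
  shows "1 - real (rho F (p\<^sup>2)) / real p ^ (2 * CARD('s)) \<in> {0..1}"
proof -
  have "real (rho F (p\<^sup>2)) \<le> real p ^ (2 * CARD('s))"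
    using rho_le[of F "p\<^sup>2"] by (metis of_nat_le_iff of_nat_power power_mult)
  moreover have "p > 0" using assms prime_gt_0_nat by blast
  ultimately show ?thesis by simp
qed

lemma singular_partial_nonneg: "singular_partial F n \<ge> 0"
  unfolding singular_partial_def by (intro prod_nonneg) (use singular_factor in auto)

lemma decseq_singular_partial: "decseq (singular_partial (F :: 's::finite int_mpoly))"
proof (rule decseq_SucI)
  fix n
  show "singular_partial F (Suc n) \<le> singular_partial F n"
  proof (cases "prime (Suc n)")
    case True
    have eq: "{p. prime p \<and> p \<le> Suc n} = insert (Suc n) {p. prime p \<and> p \<le> n}"
      using True by (auto simp: le_Suc_eq)
    have "singular_partial F (Suc n) =
        (1 - real (rho F ((Suc n)\<^sup>2)) / real (Suc n) ^ (2 * CARD('s))) * singular_partial F n"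
      unfolding singular_partial_def eq by (subst prod.insert) auto
    also have "\<dots> \<le> 1 * singular_partial F n"
      using singular_factor[OF True, of F]
      by (intro mult_right_mono singular_partial_nonneg) auto
    finally show ?thesis by simp
  next
    case False
    hence "{p. prime p \<and> p \<le> Suc n} = {p. prime p \<and> p \<le> n}"
      by (auto simp: le_Suc_eq)
    thus ?thesis by (simp add: singular_partial_def)
  qed
qed

lemma singular_partial_tendsto: "singular_partial F \<longlonglongrightarrow> singular_series F"
proof -
  have "convergent (singular_partial F)"
  proof (rule decseq_convergent[OF decseq_singular_partial])
    show "\<forall>n. 0 \<le> singular_partial F n"
      by (simp add: singular_partial_nonneg)
  qed (auto simp: convergent_def)
  thus ?thesis
    unfolding singular_series_def by (simp add: convergent_LIMSEQ_iff)
qed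

end

theory Submission
  imports Defs
begin

text \<open>
  For fixed \<open>n\<close>, a value of the polynomial that is squarefree is not divisible by \<open>p\<^sup>2\<close> for any prime
  \<open>p \<le> n\<close>. This is a condition modulo \<open>Q = \<Prod>p\<le>n. p\<^sup>2\<close>, and by the Chinese remainder theorem the
  proportion of admissible residue classes is the partial product of the singular series at \<open>n\<close>.
  Once all \<open>P\<^sub>j \<ge> Q\<close>, each residue class meets the box in at most \<open>\<Prod>j. 3 P\<^sub>j / Q\<close> points, so the
  count is at most \<open>3\<^sup>s \<Prod>j. P\<^sub>j\<close> times that partial product, which tends to \<open>0\<close> as \<open>n\<close> grows.
\<close>

section \<open>Residue classes avoiding squares of primes\<close>

lemma mpoly_eval_cong:
  assumes "\<And>j. [x j = y j] (mod m)"
  shows "[mpoly_eval F x = mpoly_eval F y] (mod m)"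
  unfolding mpoly_eval_def
  by (intro cong_sum cong_mult cong_prod cong_pow assms cong_refl)

text \<open>Reduction modulo \<open>q\<close> is invisible modulo any divisor of \<open>q\<close>.
  This lets a condition at one prime be tested after reducing modulo the full product of prime
  squares.\<close>

lemma dvd_mpoly_eval_mod_iff:
  assumes "d dvd q"
  shows "d dvd mpoly_eval F (\<lambda>j. x j mod q) \<longleftrightarrow> d dvd mpoly_eval F x"
proof -
  have "[x j mod q = x j] (mod d)" for j
    using assms by (auto simp: cong_def mod_mod_cancel)
  then have "[mpoly_eval F (\<lambda>j. x j mod q) = mpoly_eval F x] (mod d)"
    by (rule mpoly_eval_cong)
  then show ?thesis
    by (rule cong_dvd_iff)
qed

text \<open>Classes are encoded by least nonnegative representatives, as in \<open>rho\<close>. An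
  arbitrary set \<open>S\<close> of primes, rather than a bound \<open>n\<close>, allows induction
  one prime at a time.\<close>

definition nonvanishing_residues :: "'s::finite int_mpoly \<Rightarrow> nat set \<Rightarrow> ('s \<Rightarrow> int) set" where
  "nonvanishing_residues F S = {x. (\<forall>j. x j \<in> {0..<int (\<Prod>p\<in>S. p\<^sup>2)}) \<and>
     (\<forall>p\<in>S. \<not> int (p\<^sup>2) dvd mpoly_eval F x)}"

lemma finite_nonvanishing_residues: "finite (nonvanishing_residues F S)"
  by (rule finite_subset[OF _ finite_residue_box[of "\<Prod>p\<in>S. p\<^sup>2"]])
     (auto simp: nonvanishing_residues_def)

lemma card_nonvanishing_residues_singleton:
  fixes F :: "'s::finite int_mpoly"
  shows "real (card (nonvanishing_residues F {p})) = real p ^ (2 * CARD('s)) - real (rho F (p\<^sup>2))"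
proof -
  let ?B = "{x :: 's \<Rightarrow> int. \<forall>j. x j \<in> {0..<int (p\<^sup>2)}}"
  let ?Z = "{x :: 's \<Rightarrow> int. (\<forall>j. x j \<in> {0..<int (p\<^sup>2)}) \<and> [mpoly_eval F x = 0] (mod int (p\<^sup>2))}"
  have "nonvanishing_residues F {p} = ?B - ?Z"
    by (auto simp: nonvanishing_residues_def cong_0_iff)
  moreover have "card (?B - ?Z) = card ?B - card ?Z"
    by (intro card_Diff_subset finite_subset[OF _ finite_residue_box[of "p\<^sup>2"]]) auto
  moreover have "card ?B = (p\<^sup>2) ^ CARD('s)"
    unfolding residue_box by (simp add: card_PiE nat_power_eq)
  moreover have "card ?Z = rho F (p\<^sup>2)"
    by (simp add: rho_def)
  \<comment> \<open>By \<open>rho_le\<close> the subtraction of naturals does not truncate.\<close>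
  ultimately show ?thesis
    using rho_le[of F "p\<^sup>2"] by (simp add: of_nat_diff power_mult)
qed

text \<open>The Chinese remainder map, reducing modulo \<open>q\<^sup>2\<close> and modulo the old
  product, is injective on representatives and preserves the condition at every prime.\<close>

lemma card_nonvanishing_residues_insert_le:
  fixes F :: "'s::finite int_mpoly"
  assumes "finite S" "q \<notin> S" "\<forall>p\<in>insert q S. prime p"
  shows "card (nonvanishing_residues F (insert q S))
    \<le> card (nonvanishing_residues F {q}) * card (nonvanishing_residues F S)"
proof -
  let ?Q = "int (\<Prod>p\<in>S. p\<^sup>2)"
  let ?q = "int (q\<^sup>2)"
  let ?f = "\<lambda>x::'s \<Rightarrow> int. (\<lambda>j. x j mod ?q, \<lambda>j. x j mod ?Q)"
  have prod_eq: "int (\<Prod>p\<in>insert q S. p\<^sup>2) = ?q * ?Q"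
    using assms by simp
  have pos: "?q > 0" "?Q > 0"
    using assms by (auto simp: prime_gt_0_nat intro!: prod_pos)
  have "coprime q p" if "p \<in> S" for p
    using that assms by (metis insert_iff primes_coprime)
  then have "coprime (q\<^sup>2) (\<Prod>p\<in>S. p\<^sup>2)"
    by (intro prod_coprime_right) auto
  then have coprime: "coprime ?q ?Q"
    by (simp only: coprime_int_iff)
  have "card (nonvanishing_residues F (insert q S))
    \<le> card (nonvanishing_residues F {q} \<times> nonvanishing_residues F S)"
  proof (rule card_inj_on_le[where f = ?f])
    show "inj_on ?f (nonvanishing_residues F (insert q S))"
    proof (rule inj_onI)
      fix x y
      assume x: "x \<in> nonvanishing_residues F (insert q S)"
        and y: "y \<in> nonvanishing_residues F (insert q S)" and eq: "?f x = ?f y"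
      show "x = y"
      proof
        fix j
        have "[x j = y j] (mod ?q)" "[x j = y j] (mod ?Q)"
          using eq by (auto simp: cong_def dest: fun_cong)
        then have "[x j = y j] (mod ?q * ?Q)"
          using coprime by (rule coprime_cong_mult)
        moreover have "x j \<in> {0..<?q * ?Q}" "y j \<in> {0..<?q * ?Q}"
          using x y unfolding nonvanishing_residues_def prod_eq by blast+
        ultimately show "x j = y j"
          by (simp add: cong_def)
      qed
    qed
    show "?f ` nonvanishing_residues F (insert q S)
      \<subseteq> nonvanishing_residues F {q} \<times> nonvanishing_residues F S"
    proof (intro image_subsetI SigmaI)
      fix x assume x: "x \<in> nonvanishing_residues F (insert q S)"
      show "(\<lambda>j. x j mod ?q) \<in> nonvanishing_residues F {q}"
        using x pos(1) dvd_mpoly_eval_mod_iff[of ?q ?q F x]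
        by (auto simp: nonvanishing_residues_def)
      have "int (p\<^sup>2) dvd ?Q" if "p \<in> S" for p
        using that assms(1) by (simp only: int_dvd_int_iff) (rule dvd_prodI)
      then show "(\<lambda>j. x j mod ?Q) \<in> nonvanishing_residues F S"
        using x pos(2) dvd_mpoly_eval_mod_iff[of _ ?Q F x]
        unfolding nonvanishing_residues_def by auto
    qed
  qed (simp add: finite_nonvanishing_residues)
  then show ?thesis
    by (simp add: card_cartesian_product)
qed

text \<open>Each new prime multiplies the modulus by its square and the density by its local
  factor.\<close>

lemma card_nonvanishing_residues_le:
  fixes F :: "'s::finite int_mpoly"
  assumes "finite S" "\<forall>p\<in>S. prime p"
  shows "real (card (nonvanishing_residues F S))
    \<le> real (\<Prod>p\<in>S. p\<^sup>2) ^ CARD('s) * (\<Prod>p\<in>S. 1 - real (rho F (p\<^sup>2)) / real p ^ (2 * CARD('s)))"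
  using assms
proof (induction S rule: finite_induct)
  case empty
  \<comment> \<open>The empty product gives modulus 1, whose only representative is 0 in each
    coordinate.\<close>
  have "nonvanishing_residues F {} \<subseteq> {\<lambda>_. 0}"
    by (auto simp: nonvanishing_residues_def fun_eq_iff)
      (metis order.antisym add_0 zle_add1_eq_le)
  then have "card (nonvanishing_residues F {}) \<le> 1"
    using card_mono[of "{\<lambda>_::'s. 0::int}"] by simp
  then show ?case by simp
next
  case (insert q S)
  let ?d = "\<lambda>p. 1 - real (rho F (p\<^sup>2)) / real p ^ (2 * CARD('s))"
  have "q > 0"
    using insert.prems by (simp add: prime_gt_0_nat)
  then have one: "real (card (nonvanishing_residues F {q})) = real (q\<^sup>2) ^ CARD('s) * ?d q"
    unfolding card_nonvanishing_residues_singleton power_mult of_nat_power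
    by (simp add: right_diff_distrib)
  have "real (card (nonvanishing_residues F (insert q S)))
      \<le> real (card (nonvanishing_residues F {q})) * real (card (nonvanishing_residues F S))"
    using card_nonvanishing_residues_insert_le[OF insert.hyps insert.prems, of F]
    by (metis of_nat_le_iff of_nat_mult)
  also have "\<dots> \<le> real (card (nonvanishing_residues F {q})) *
      (real (\<Prod>p\<in>S. p\<^sup>2) ^ CARD('s) * (\<Prod>p\<in>S. ?d p))"
    using insert by (intro mult_left_mono) auto
  also have "\<dots> = real (\<Prod>p\<in>insert q S. p\<^sup>2) ^ CARD('s) * (\<Prod>p\<in>insert q S. ?d p)"
    using insert.hyps unfolding one by (simp add: power_mult_distrib mult_ac)
  finally show ?case .
qed

section \<open>Box points in prescribed residue classes\<close>

text \<open>The quotients \<open>n div q\<close> are distinct integers in a real interval of length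
  \<open>2 * P / q\<close>, so there are at most \<open>2 * P / q + 1\<close> of them.\<close>

lemma card_residue_class_interval_le:
  fixes q r :: int and P :: real
  assumes "q > 0" "real_of_int q \<le> P"
  shows "real (card {n. \<bar>real_of_int n\<bar> \<le> P \<and> n mod q = r}) \<le> 3 * P / q"
proof -
  let ?A = "{n. \<bar>real_of_int n\<bar> \<le> P \<and> n mod q = r}"
  let ?K = "{\<lceil>(- P - r) / q\<rceil>..\<lfloor>(P - r) / q\<rfloor>}"
  have "card ?A \<le> card ?K"
  proof (rule card_inj_on_le[where f = "\<lambda>n. n div q"])
    show "inj_on (\<lambda>n. n div q) ?A"
      by (rule inj_onI) (metis (mono_tags, lifting) mem_Collect_eq mult_div_mod_eq)
    show "(\<lambda>n. n div q) ` ?A \<subseteq> ?K"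
    proof (intro image_subsetI)
      fix n assume n: "n \<in> ?A"
      then have "n = q * (n div q) + r"
        by (metis (mono_tags, lifting) mem_Collect_eq mult_div_mod_eq)
      then have "real_of_int n = real_of_int q * real_of_int (n div q) + real_of_int r"
        by (metis of_int_add of_int_mult)
      then show "n div q \<in> ?K"
        using n assms(1) by (auto simp: ceiling_le_iff le_floor_iff field_simps abs_le_iff)
    qed
  qed simp
  \<comment> \<open>The \<open>max 0\<close> mirrors the truncation in the cardinality of an integer
    interval.\<close>
  also have "real (card ?K) \<le> max 0 ((P - r) / q - (- P - r) / q + 1)"
    by simp linarith
  also have "\<dots> = 2 * P / q + 1"
    using assms by (simp add: field_simps max_def)
  \<comment> \<open>Since \<open>q \<le> P\<close>, the extra 1 is at most
    \<open>P / q\<close>.\<close>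
  also have "\<dots> \<le> 3 * P / q"
    using assms by (simp add: field_simps)
  finally show ?thesis by simp
qed

text \<open>The box is fibred over residue vectors. Each fibre is a product of one-dimensional
  classes, bounded coordinate by coordinate.\<close>

lemma card_box_residues_le:
  fixes P :: "'s::finite \<Rightarrow> real" and T :: "('s \<Rightarrow> int) set" and q :: int
  assumes "finite T" "q > 0" "\<And>j. real_of_int q \<le> P j"
  shows "real (card {x. (\<forall>j. \<bar>real_of_int (x j)\<bar> \<le> P j) \<and> (\<lambda>j. x j mod q) \<in> T})
    \<le> real (card T) * (\<Prod>j\<in>UNIV. 3 * P j / q)"
proof -
  let ?A = "\<lambda>r j. {n. \<bar>real_of_int n\<bar> \<le> P j \<and> n mod q = r j}"
  have "{x. (\<forall>j. \<bar>real_of_int (x j)\<bar> \<le> P j) \<and> (\<lambda>j. x j mod q) \<in> T}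
      = (\<Union>r\<in>T. PiE UNIV (?A r))"
    by (auto simp: PiE_def Pi_def)
  then have "real (card {x. (\<forall>j. \<bar>real_of_int (x j)\<bar> \<le> P j) \<and> (\<lambda>j. x j mod q) \<in> T})
      \<le> (\<Sum>r\<in>T. real (card (PiE UNIV (?A r))))"
    using card_UN_le[OF assms(1), of "\<lambda>r. PiE UNIV (?A r)"]
    by (simp only: of_nat_le_iff flip: of_nat_sum)
  also have "\<dots> = (\<Sum>r\<in>T. \<Prod>j\<in>UNIV. real (card (?A r j)))"
    by (simp add: card_PiE)
  also have "\<dots> \<le> (\<Sum>r\<in>T. \<Prod>j\<in>UNIV. 3 * P j / q)"
    using assms by (intro sum_mono prod_mono conjI card_residue_class_interval_le) auto
  finally show ?thesis by simp
qed

section \<open>Squarefree values in a box\<close>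

text \<open>At 0 both sides vanish, because 0 is not \<open>squarefree\<close>.\<close>

lemma moebius_square: "(moebius n)\<^sup>2 = (if squarefree n then 1 else 0)"
proof -
  have "((- 1) ^ k)\<^sup>2 = (1 :: int)" for k :: nat
    by (cases "even k") auto
  then show ?thesis
    by (auto simp: moebius_def)
qed

lemma squarefree_count_eq_card:
  "squarefree_count F P =
    int (card {x. (\<forall>j. \<bar>real_of_int (x j)\<bar> \<le> P j) \<and> squarefree (nat \<bar>mpoly_eval F x\<bar>)})"
  unfolding squarefree_count_def moebius_square
  using sum.inter_filter[OF finite_box[of P], of "\<lambda>_. 1 :: int"
      "\<lambda>x. squarefree (nat \<bar>mpoly_eval F x\<bar>)"]
  by simp

lemma squarefree_count_le:
  fixes F :: "'s::finite int_mpoly"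
  assumes "\<And>j. real (\<Prod>p | prime p \<and> p \<le> n. p\<^sup>2) \<le> P j"
  shows "real_of_int (squarefree_count F P)
    \<le> 3 ^ CARD('s) * singular_partial F n * (\<Prod>j\<in>UNIV. P j)"
proof -
  define S where "S = {p::nat. prime p \<and> p \<le> n}"
  define Q where "Q = (\<Prod>p\<in>S. p\<^sup>2)"
  have S: "finite S" "\<forall>p\<in>S. prime p"
    by (auto simp: S_def)
  have Q: "Q > 0"
    using S by (auto simp: Q_def prime_gt_0_nat intro!: prod_pos)
  have QP: "real Q \<le> P j" for j
    using assms by (simp add: Q_def S_def)
  have P: "P j \<ge> 0" for j
    using QP[of j] of_nat_0_le_iff[of Q] by linarith
  let ?T = "nonvanishing_residues F S"
  let ?D = "{x. (\<forall>j. \<bar>real_of_int (x j)\<bar> \<le> P j) \<and> squarefree (nat \<bar>mpoly_eval F x\<bar>)}"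
  let ?E = "{x. (\<forall>j. \<bar>real_of_int (x j)\<bar> \<le> P j) \<and> (\<lambda>j. x j mod int Q) \<in> ?T}"
  \<comment> \<open>A squarefree value is divisible by no \<open>p\<^sup>2\<close>, so the point
    reduces modulo \<open>Q\<close> to an admissible class.\<close>
  have "?D \<subseteq> ?E"
  proof clarify
    fix x assume sf: "squarefree (nat \<bar>mpoly_eval F x\<bar>)"
    have "\<not> int (p\<^sup>2) dvd mpoly_eval F (\<lambda>j. x j mod int Q)" if p: "p \<in> S" for p
    proof
      assume "int (p\<^sup>2) dvd mpoly_eval F (\<lambda>j. x j mod int Q)"
      moreover have "int (p\<^sup>2) dvd int Q"
        using p S(1) unfolding Q_def int_dvd_int_iff by (rule dvd_prodI[rotated])
      ultimately have "int (p\<^sup>2) dvd mpoly_eval F x"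
        using dvd_mpoly_eval_mod_iff by blast
      then have "p\<^sup>2 dvd nat \<bar>mpoly_eval F x\<bar>"
        by (metis int_dvd_int_iff dvd_abs_iff nat_0_le abs_ge_zero)
      then have "is_unit p"
        using sf unfolding squarefree_def by blast
      then show False
        using p S(2) not_prime_unit by blast
    qed
    then show "(\<lambda>j. x j mod int Q) \<in> ?T"
      using Q unfolding nonvanishing_residues_def Q_def[symmetric] by simp
  qed
  moreover have "finite ?E"
    by (rule finite_subset[OF _ finite_box[of P]]) auto
  ultimately have "real_of_int (squarefree_count F P) \<le> real (card ?E)"
    unfolding squarefree_count_eq_card by (simp add: card_mono)
  also have "\<dots> \<le> real (card ?T) * (\<Prod>j\<in>UNIV. 3 * P j / real_of_int (int Q))"
    using Q QP by (intro card_box_residues_le finite_nonvanishing_residues) auto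
  also have "\<dots> \<le> (real Q ^ CARD('s) * singular_partial F n) *
      (\<Prod>j\<in>UNIV. 3 * P j / real_of_int (int Q))"
  proof (rule mult_right_mono)
    show "real (card ?T) \<le> real Q ^ CARD('s) * singular_partial F n"
      using card_nonvanishing_residues_le[OF S, of F]
      by (simp only: Q_def S_def singular_partial_def)
    show "(\<Prod>j\<in>UNIV. 3 * P j / real_of_int (int Q)) \<ge> 0"
      using P by (intro prod_nonneg) simp
  qed
  \<comment> \<open>The \<open>CARD('s)\<close> divisions by \<open>Q\<close> cancel the power of
    \<open>Q\<close>, leaving a constant independent of \<open>n\<close>.\<close>
  also have "\<dots> = 3 ^ CARD('s) * singular_partial F n * (\<Prod>j\<in>UNIV. P j)"
    using Q by (simp add: prod_dividef prod.distrib)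
  finally show ?thesis .
qed

theorem theorem1p3:
  fixes F :: "'s::finite int_mpoly"
  assumes "CARD('s) \<ge> 2"
    and "singular_series F = 0"
  shows "(\<lambda>P :: 's \<Rightarrow> real. real_of_int (squarefree_count F P))
           \<in> o[inf (filtercomap (\<lambda>P. Min (range P)) at_top) (principal {P. \<forall>j. P j \<ge> 1})](\<lambda>P.
               \<Prod>j\<in>UNIV. P j)"
proof (rule landau_o.smallI)
  fix c :: real
  assume "c > 0"
  \<comment> \<open>The threshold absorbs the factor \<open>3 ^ CARD('s)\<close>. The cutoff
    \<open>n\<close> depends on \<open>c\<close> alone and is fixed before \<open>P\<close>
    varies.\<close>
  then have "eventually (\<lambda>n. singular_partial F n < c / 3 ^ CARD('s)) sequentially"
    using singular_partial_tendsto[of F] assms(2) by (intro order_tendstoD) auto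
  then obtain n where n: "singular_partial F n < c / 3 ^ CARD('s)"
    by (auto simp: eventually_sequentially)
  \<comment> \<open>\<open>R\<close> is the modulus for this \<open>n\<close>: every side must reach
    it before \<open>squarefree_count_le\<close> applies.\<close>
  define R where "R = real (\<Prod>p | prime p \<and> p \<le> n. p\<^sup>2)"
  have bound: "norm (real_of_int (squarefree_count F P)) \<le> c * norm (\<Prod>j\<in>UNIV. P j)"
    if min: "Min (range P) \<ge> R" and ge1: "\<forall>j. P j \<ge> 1" for P :: "'s \<Rightarrow> real"
  proof -
    have nonneg: "(\<Prod>j\<in>UNIV. P j) \<ge> 0"
      using ge1 by (intro prod_nonneg) (meson order_trans zero_le_one)
    have "R \<le> P j" for j
      using min by (meson Min_le finite_imageI finite order_trans rangeI)
    then have "real_of_int (squarefree_count F P)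
        \<le> 3 ^ CARD('s) * singular_partial F n * (\<Prod>j\<in>UNIV. P j)"
      unfolding R_def by (rule squarefree_count_le)
    also have "\<dots> \<le> c * (\<Prod>j\<in>UNIV. P j)"
    proof (rule mult_right_mono[OF _ nonneg])
      show "3 ^ CARD('s) * singular_partial F n \<le> c"
        using n by (simp add: less_divide_eq mult.commute)
    qed
    finally show ?thesis
      using nonneg by (simp only: squarefree_count_eq_card real_norm_def abs_of_nonneg
          of_int_of_nat_eq of_nat_0_le_iff)
  qed
  have "eventually (\<lambda>P :: 's \<Rightarrow> real. Min (range P) \<ge> R) (filtercomap (\<lambda>P. Min (range P)) at_top)"
    by (intro eventually_filtercomapI eventually_ge_at_top)
  then show "eventually (\<lambda>P :: 's \<Rightarrow> real.
      norm (real_of_int (squarefree_count F P)) \<le> c * norm (\<Prod>j\<in>UNIV. P j))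
      (inf (filtercomap (\<lambda>P. Min (range P)) at_top) (principal {P. \<forall>j. P j \<ge> 1}))"
    unfolding eventually_inf_principal by (rule eventually_mono) (use bound in auto)
qed

end
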